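(* For every integer $n\geq 1$, the characteristic polynomial $P_n(x)=\det(xI-M_n)$ of the matrix $M_n$ divides the characteristic polynomial $P_{n+1}(x)=\det(xI-M_{n+1})$ of the matrix $M_{n+1}$ in $\mathbb{Z}[x]$.
   Context: $\mathfrak{S}_n$ denotes the symmetric group on $\{1,\dots,n\}$. A descent of $\sigma\in\mathfrak{S}_n$ is an integer $i\in\{1,\dots,n-1\}$ such that $\sigma(i)>\sigma(i+1)$; $\mathrm{Des}(\sigma)$ is the set of descents of $\sigma$. A recoil of $\sigma$ is a descent of $\sigma^{-1}$; $\mathrm{Rec}(\sigma)=\mathrm{Des}(\sigma^{-1})$ is the set of recoils of $\sigma$. $M_n$ is the $n!\times n!$ matrix with rows and columns indexed by $\mathfrak{S}_n$, with entries $M_n(\sigma,\tau)=1$ if $\mathrm{Rec}(\tau)\subseteq\mathrm{Des}(\sigma)$, and $M_n(\sigma,\tau)=0$ otherwise. *)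

theory Defs
  imports "HOL-Combinatorics.Permutations" "Jordan_Normal_Form.Char_Poly"
begin

text \<open>
  A permutation of \<open>{1..n}\<close> is a function \<open>\<sigma>\<close> with \<open>\<sigma> permutes {1..n}\<close>; it is the identity
  outside \<open>{1..n}\<close>, so its inverse in the symmetric group is the inverse of the total function.
\<close>

definition Sym :: "nat \<Rightarrow> (nat \<Rightarrow> nat) set" where
  "Sym n = {\<sigma>. \<sigma> permutes {1..n}}"

definition Des :: "nat \<Rightarrow> (nat \<Rightarrow> nat) \<Rightarrow> nat set" where
  "Des n \<sigma> = {i \<in> {1..<n}. \<sigma> i > \<sigma> (i + 1)}"

definition Rec :: "nat \<Rightarrow> (nat \<Rightarrow> nat) \<Rightarrow> nat set" where
  "Rec n \<sigma> = Des n (Hilbert_Choice.inv \<sigma>)"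

definition M_entry :: "nat \<Rightarrow> (nat \<Rightarrow> nat) \<Rightarrow> (nat \<Rightarrow> nat) \<Rightarrow> int" where
  "M_entry n \<sigma> \<tau> = (if Rec n \<tau> \<subseteq> Des n \<sigma> then 1 else 0)"

text \<open>
  The library's matrices are indexed by initial segments of the naturals, so the rows and
  columns are listed along a common enumeration \<open>e\<close> of the symmetric group. Changing \<open>e\<close>
  conjugates the matrix by a permutation matrix.
\<close>

definition enumeration :: "nat \<Rightarrow> (nat \<Rightarrow> nat \<Rightarrow> nat) \<Rightarrow> bool" where
  "enumeration n e \<longleftrightarrow> bij_betw e {..<fact n} (Sym n)"

definition M :: "nat \<Rightarrow> (nat \<Rightarrow> nat \<Rightarrow> nat) \<Rightarrow> int mat" where
  "M n e = mat (fact n) (fact n) (\<lambda>(i, j). M_entry n (e i) (e j))"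

lemma enumeration_exists: "\<exists>e. enumeration n e"
proof -
  have "finite (Sym n)" and "card (Sym n) = fact n"
    by (simp_all add: Sym_def finite_permutations card_permutations)
  then show ?thesis
    using ex_bij_betw_nat_finite[of "Sym n"]
    by (auto simp: enumeration_def atLeast0LessThan)
qed

end

theory Submission
  imports Defs
begin

text \<open>
  The divisibility holds because \<open>M n\<close> is the action induced by \<open>M (n + 1)\<close> on a quotient: there
  is a surjective linear map \<open>D\<close> from the functions on \<open>Sym (n + 1)\<close> to the functions on \<open>Sym n\<close>,
  over the rationals, with \<open>D M(n+1) = M(n) D\<close>.

  Replacing \<open>\<sigma>\<close> by the word of \<open>\<sigma>\<^sup>-\<^sup>1\<close> on rows and columns, the entry of the matrix at \<open>(a, w)\<close>
  is \<open>1\<close> if \<open>Des w \<subseteq> Rec a\<close> and \<open>0\<close> otherwise, so that \<open>w\<close> is sent to the sum of all shuffles of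
  decreasing words whose lengths are those of the maximal decreasing runs of \<open>w\<close>. The map \<open>D\<close> deletes one
  letter in all possible ways, with sign \<open>1\<close> for a double ascent, \<open>-1\<close> for a double descent and
  \<open>0\<close> otherwise, where the word is bordered by \<open>-\<infinity>\<close> and \<open>+\<infinity>\<close>. Deleting such a letter from
  \<open>w\<close> shortens one run and keeps the others. On the other hand \<open>D\<close> is a derivation for
  the shuffle product: the places where a letter \<open>x\<close> can be inserted between two given letters of
  its own factor have signs that telescope, and only the comparison of \<open>x\<close> with these two letters
  remains. The lemma \<open>sum_jump_Des\<close> is this telescoping argument in a form that avoids
  shuffles, and \<open>deletion_commutes\<close> is the resulting commutation.

  Surjectivity comes from the relation \<open>D T = 1 + T D\<close>, where \<open>T\<close> appends a new largest letter
  (\<open>deletion_Suc\<close>, \<open>deletion_surj\<close>). The passage from the intertwining map to characteristic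
  polynomials is \<open>char_poly_dvd_if_intertwined\<close>; since the characteristic polynomial is
  monic, divisibility over the rationals descends to the integers.
\<close>

section \<open>Divisibility of determinants from an intertwining map\<close>

text \<open>
  Over a field the reason is that \<open>ker D\<close> is \<open>A\<close>-invariant and \<open>A\<close> induces \<open>B\<close> on the quotient.
  The proof avoids choosing a basis adapted to the kernel, and so works over any integral domain:
  with the projection \<open>F = 1 - R D\<close> onto \<open>ker D\<close>, the block matrix \<open>L = [F, R; D, 0]\<close> is an
  involution, and conjugating \<open>diag(A, 1)\<close> by \<open>L\<close> gives a block triangular matrix with \<open>B\<close> in
  its lower right corner.
\<close>

lemma det_dvd_det_if_intertwined:
  fixes A B :: "'a :: idom mat"
  assumes A: "A \<in> carrier_mat N N" and B: "B \<in> carrier_mat m m"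
    and D: "D \<in> carrier_mat m N" and R: "R \<in> carrier_mat N m"
    and DA: "D * A = B * D" and DR: "D * R = 1\<^sub>m m"
  shows "det B dvd det A"
proof -
  define F where "F = 1\<^sub>m N - R * D"
  have RD: "R * D \<in> carrier_mat N N" using R D by simp
  have F: "F \<in> carrier_mat N N" unfolding F_def using RD by (rule minus_carrier_mat)
  have FR: "F * R = 0\<^sub>m N m"
  proof -
    have "F * R = R - R * (D * R)"
      unfolding F_def using R D RD by (simp add: minus_mult_distrib_mat[OF _ RD R] assoc_mult_mat[OF R D R])
    then show ?thesis using R by (simp add: DR)
  qed
  have DF: "D * F = 0\<^sub>m m N"
  proof -
    have "D * F = D - (D * R) * D"
      unfolding F_def using R D RD by (simp add: mult_minus_distrib_mat[OF D _ RD] assoc_mult_mat[OF D R D])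
    then show ?thesis using D by (simp add: DR)
  qed
  have FF: "F * F + R * D = 1\<^sub>m N"
  proof -
    have "F * F = F - (F * R) * D"
      using R D RD F by (subst (2) F_def) (simp add: mult_minus_distrib_mat[OF F _ RD] assoc_mult_mat[OF F R D])
    then have "F * F = F" using F D by (simp add: FR) (intro eq_matI, auto)
    then show ?thesis using R D by (intro eq_matI) (auto simp: F_def)
  qed
  have DAF: "D * A * F = 0\<^sub>m m N"
    using B D F by (simp add: DA assoc_mult_mat[OF B D F] DF)
  have DAR: "D * A * R = B"
    using B D R by (simp add: DA assoc_mult_mat[OF B D R] DR)
  define L where "L = four_block_mat F R D (0\<^sub>m m m)"
  define X where "X = four_block_mat A (0\<^sub>m N m) (0\<^sub>m m N) (1\<^sub>m m)"
  have L: "L \<in> carrier_mat (N + m) (N + m)" and X: "X \<in> carrier_mat (N + m) (N + m)"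
    using F A by (auto simp: L_def X_def)
  have LL: "L * L = 1\<^sub>m (N + m)"
    unfolding L_def
    by (subst mult_four_block_mat[OF F R D _ F R D]) (use F R D in \<open>simp_all add: FF FR DF DR\<close>)
  have FA: "F * A \<in> carrier_mat N N" and DA': "D * A \<in> carrier_mat m N"
    using F A D by auto
  have "L * X = four_block_mat (F * A) R (D * A) (0\<^sub>m m m)"
    unfolding L_def X_def
    by (subst mult_four_block_mat[OF F R D _ A, of _ _ m]) (use F R D A FA DA' in simp_all)
  then have LXL: "L * X * L = four_block_mat (F * A * F + R * D) (F * A * R) (0\<^sub>m m N) B"
    unfolding L_def
    by (simp, subst mult_four_block_mat[OF FA R DA' _ F R D])
       (use F R D A B FA DA' in \<open>simp_all add: DAF DAR\<close>)
  have "det A = det X"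
    unfolding X_def by (subst det_four_block_mat_lower_left_zero[OF A]) auto
  also have "\<dots> = det L * det X * det L"
  proof -
    have "det L * det L = 1" using det_mult[OF L L] LL by simp
    then show ?thesis by (simp add: mult.commute mult.left_commute)
  qed
  also have "\<dots> = det (L * X * L)"
    using L X by (simp add: det_mult[of _ "N + m"])
  also have "\<dots> = det (F * A * F + R * D) * det B"
    unfolding LXL by (rule det_four_block_mat_lower_left_zero) (use F R D A B in auto)
  finally show ?thesis by simp
qed

text \<open>
  The intertwining relation for \<open>A\<close> and \<open>B\<close> passes to \<open>xI - A\<close> and \<open>xI - B\<close>, with the entries of
  \<open>D\<close> and \<open>R\<close> read as constant polynomials.
\<close>

lemma char_poly_dvd_if_intertwined:
  fixes A B :: "'a :: idom mat"
  assumes A: "A \<in> carrier_mat N N" and B: "B \<in> carrier_mat m m"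
    and D: "D \<in> carrier_mat m N" and R: "R \<in> carrier_mat N m"
    and DA: "D * A = B * D" and DR: "D * R = 1\<^sub>m m"
  shows "char_poly B dvd char_poly A"
proof -
  interpret C: comm_ring_hom "\<lambda>a :: 'a. [:a:]"
    by unfold_locales (auto simp: one_pCons)
  let ?C = "map_mat (\<lambda>a :: 'a. [:a:])"
  have cp: "char_poly_matrix Y = [:0, 1:] \<cdot>\<^sub>m 1\<^sub>m k - ?C Y" if "Y \<in> carrier_mat k k" for Y k
    unfolding char_poly_matrix_def using that by (intro eq_matI) auto
  have cA: "?C A \<in> carrier_mat N N" and cB: "?C B \<in> carrier_mat m m"
    and cD: "?C D \<in> carrier_mat m N" and cR: "?C R \<in> carrier_mat N m"
    using A B D R by auto
  have "?C D * ?C A = ?C B * ?C D"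
    using DA C.mat_hom_mult[OF D A] C.mat_hom_mult[OF B D] by simp
  then have "?C D * char_poly_matrix A = char_poly_matrix B * ?C D"
    unfolding cp[OF A] cp[OF B]
    using cA cB cD
    by (simp add: mult_minus_distrib_mat[OF cD _ cA] minus_mult_distrib_mat[OF _ cB cD]
        mult_smult_distrib[OF cD one_carrier_mat] mult_smult_assoc_mat[OF one_carrier_mat cD])
  moreover have "?C D * ?C R = 1\<^sub>m m"
    using DR C.mat_hom_mult[OF D R] by (simp add: C.mat_hom_one)
  ultimately show ?thesis
    unfolding char_poly_def
    by (intro det_dvd_det_if_intertwined[OF _ _ cD cR]) (use A B in auto)
qed

text \<open>
  Division by a monic polynomial stays inside the integer polynomials, and over the field its
  remainder must vanish for degree reasons.
\<close>

lemma monic_dvd_if_of_int_poly_dvd: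
  fixes p q :: "int poly"
  assumes "monic p"
    and dvd: "(map_poly of_int p :: 'a :: field_char_0 poly) dvd map_poly of_int q"
  shows "p dvd q"
proof -
  let ?h = "map_poly of_int :: int poly \<Rightarrow> 'a poly"
  have p0: "p \<noteq> 0" using assms(1) by auto
  obtain s r where sr: "pseudo_divmod q p = (s, r)" by (metis surj_pair)
  have q: "q = p * s + r" and r: "r = 0 \<or> degree r < degree p"
    using pseudo_divmod[OF p0 sr] assms(1) by auto
  have "?h q = ?h p * ?h s + ?h r" by (simp add: q hom_distribs)
  with dvd have "?h p dvd ?h r" by (metis dvd_add_times_triv_left_iff mult.commute)
  then have "r = 0"
    using r dvd_imp_degree_le[of "?h p" "?h r"] by fastforce
  with q show ?thesis by simp
qed

section \<open>Inserting a letter into a permutation\<close>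

text \<open>
  In terms of permutation matrices, a new point \<open>(i, v)\<close> is inserted, and the rows and columns from
  \<open>i\<close> and \<open>v\<close> onwards move up by one. On words, the letter \<open>v\<close> is put in at position \<open>i\<close> after
  the letters \<open>\<ge> v\<close> have been increased. No size occurs in the definition because permutations are
  functions on all naturals.
\<close>

definition ins :: "(nat \<Rightarrow> nat) \<Rightarrow> nat \<Rightarrow> nat \<Rightarrow> nat \<Rightarrow> nat" where
  "ins c i v k =
    (if k = i then v
     else let x = c (if k < i then k else k - 1) in if x < v then x else x + 1)"

text \<open>
  The value is \<open>1\<close> if the new letter of \<open>ins c i v\<close> is larger than its left neighbour and
  smaller than its right neighbour, \<open>-1\<close> if it is smaller than the left and larger than the right
  one, and \<open>0\<close> at peaks and valleys. A permutation of \<open>{1..n}\<close> fixes \<open>0\<close> and \<open>n + 1\<close>, which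
  gives the boundary conventions \<open>-\<infinity>\<close> on the left and \<open>+\<infinity>\<close> on the right.
\<close>

definition jump :: "(nat \<Rightarrow> nat) \<Rightarrow> nat \<Rightarrow> nat \<Rightarrow> int" where
  "jump c i v = of_bool (v \<le> c i) - of_bool (v \<le> c (i - 1))"

lemma ins_inverse:
  assumes "\<And>x. c' (c x) = x"
  shows "ins c' v i (ins c i v k) = k"
  using assms by (auto simp: ins_def Let_def)

lemma Sym_fixes: "c \<in> Sym n \<Longrightarrow> k = 0 \<or> n < k \<Longrightarrow> c k = k"
  by (auto simp: Sym_def permutes_def)

lemma Sym_le: "c \<in> Sym n \<Longrightarrow> k \<le> n \<Longrightarrow> c k \<le> n"
  using Sym_fixes[of c n 0] permutes_in_image[of c "{1..n}" k]
  by (cases "k = 0") (auto simp: Sym_def)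

lemma Sym_inv: "c \<in> Sym n \<Longrightarrow> Hilbert_Choice.inv c \<in> Sym n"
  by (simp add: Sym_def permutes_inv)

lemma Sym_inverses:
  assumes "c \<in> Sym n"
  shows "Hilbert_Choice.inv c (c x) = x" "c (Hilbert_Choice.inv c x) = x"
  using assms by (auto simp: Sym_def permutes_inverses)

text \<open>
  Inversion transposes the permutation matrix, so it exchanges the coordinates of the new point.
\<close>

lemma inv_ins:
  assumes "c \<in> Sym n"
  shows "Hilbert_Choice.inv (ins c i v) = ins (Hilbert_Choice.inv c) v i"
  by (rule inv_unique_comp)
     (auto simp: fun_eq_iff ins_inverse Sym_inverses[OF assms])

lemma ins_in_Sym:
  assumes c: "c \<in> Sym n" and "i \<in> {1..n + 1}" "v \<in> {1..n + 1}"
  shows "ins c i v \<in> Sym (n + 1)"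
proof -
  have "ins c i v k = k" if "k \<notin> {1..n + 1}" for k
    using that assms Sym_fixes[OF c, of k] Sym_fixes[OF c, of "k - 1"]
    by (cases k) (auto simp: ins_def Let_def)
  moreover have "\<exists>!x. ins c i v x = y" for y
    by (metis ins_inverse Sym_inverses[OF c])
  ultimately show ?thesis by (auto simp: Sym_def permutes_def)
qed

lemma finite_Sym: "finite (Sym n)" and card_Sym: "card (Sym n) = fact n"
  by (simp_all add: Sym_def finite_permutations card_permutations)

lemma ins_cancel:
  assumes eq: "ins c i v = ins d i w"
  shows "c = d \<and> v = w"
proof -
  have vw: "v = w" using fun_cong[OF eq, of i] by (simp add: ins_def)
  have "c k = d k" for k
    using fun_cong[OF eq, of "if k < i then k else k + 1"] vw
    by (auto simp: ins_def Let_def split: if_splits)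
  with vw show ?thesis by auto
qed

lemma bij_betw_ins:
  assumes i: "i \<in> {1..n + 1}"
  shows "bij_betw (\<lambda>(c, v). ins c i v) (Sym n \<times> {1..n + 1}) (Sym (n + 1))"
proof -
  let ?f = "\<lambda>(c, v). ins c i v" and ?P = "Sym n \<times> {1..n + 1}"
  have inj: "inj_on ?f ?P" by (auto simp: inj_on_def dest: ins_cancel)
  have "?f ` ?P \<subseteq> Sym (n + 1)" using ins_in_Sym i by auto
  moreover have "card (?f ` ?P) = card (Sym (n + 1))"
    using inj by (simp add: card_image card_cartesian_product card_Sym)
  ultimately have "?f ` ?P = Sym (n + 1)" by (intro card_subset_eq finite_Sym)
  with inj show ?thesis by (simp add: bij_betw_def)
qed

lemma Des_ins:
  assumes "j \<in> {1..n + 1}"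
  shows "k \<in> Des (n + 1) (ins c j u) \<longleftrightarrow>
    (if k + 1 < j then k \<in> Des n c
     else if k + 1 = j then 1 \<le> k \<and> u \<le> c k
     else if k = j then j \<le> n \<and> c j < u
     else k - 1 \<in> Des n c)"
  using assms by (auto simp: Des_def ins_def Let_def)

lemma sum_telescope_window:
  fixes s :: "nat \<Rightarrow> int"
  assumes "R \<le> m"
  shows "(\<Sum>i = 1..m. (s i - s (i - 1)) * of_bool (L < i \<and> i \<le> R)) = (if L \<le> R then s R - s L else 0)"
proof -
  have "(\<Sum>i = 1..m. (s i - s (i - 1)) * of_bool (L < i \<and> i \<le> R)) = (\<Sum>i = Suc L..R. s i - s (i - 1))"
    by (rule sum.mono_neutral_cong_right) (use assms in auto)
  then show ?thesis using sum_telescope''[of L R s] by auto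
qed

text \<open>
  This is the heart of the commutation. Inserting the letter \<open>j\<close> into the word \<open>b\<close> at position \<open>i\<close>
  affects only the recoils \<open>j - 1\<close> and \<open>j\<close>: whether these are present depends on which side of the
  old letters \<open>j - 1\<close> and \<open>j\<close> the position \<open>i\<close> lies, and the other recoils are those of \<open>b\<close>,
  shifted. Hence the inclusion, as a condition on \<open>i\<close>, describes an interval \<open>L < i \<le> R\<close>. Since
  \<open>jump\<close> is a difference in \<open>i\<close>, the sum over that interval telescopes to its two ends, and there
  it agrees with the sign of the letter at position \<open>j\<close> of \<open>ins c j u\<close>.
\<close>

lemma sum_jump_Des:
  assumes b: "b \<in> Sym n" and c: "c \<in> Sym n" and j: "j \<in> {1..n + 1}" and u: "u \<in> {1..n + 1}"
  shows "(\<Sum>i = 1..n + 1. jump b i j *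
            of_bool (Des (n + 1) (ins c j u) \<subseteq> Rec (n + 1) (ins b i j)))
       = jump c j u * of_bool (Des n c \<subseteq> Rec n b)"
proof -
  \<comment> \<open>\<open>d k\<close> is the position of the letter \<open>k\<close> in the word \<open>b\<close>.\<close>
  define d where "d = Hilbert_Choice.inv b"
  have d: "d \<in> Sym n" unfolding d_def using b by (rule Sym_inv)
  have bd: "b (d x) = x" for x using Sym_inverses[OF b] by (simp add: d_def)
  have d_inj: "d x = d y \<longleftrightarrow> x = y" for x y by (metis bd)
  \<comment> \<open>\<open>up\<close> and \<open>down\<close> say that \<open>j - 1\<close> and \<open>j\<close> are descents of \<open>ins c j u\<close>.\<close>
  define up where "up \<longleftrightarrow> u \<le> c (j - 1)"
  define down where "down \<longleftrightarrow> c j < u"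
  define away where "away \<longleftrightarrow> (\<forall>k. k + 1 \<noteq> j \<longrightarrow> k \<in> Des n c \<longrightarrow> k \<in> Des n d)"
  define L where "L = (if down then d j else 0)"
  define R where "R = (if up then d (j - 1) else n + 1)"
  have d_le: "d k \<le> n + 1" if "k \<le> n + 1" for k
    using that Sym_le[OF d, of k] Sym_fixes[OF d, of k] by (cases "k \<le> n") auto
  have up_pos: "2 \<le> j" if up
    using that u j Sym_fixes[OF c, of 0] unfolding up_def by (cases "j = 1") auto
  have down_le: "j \<le> n" if down
    using that u j Sym_fixes[OF c, of "n + 1"] unfolding down_def by (cases "j = n + 1") auto
  have sub: "Des (n + 1) (ins c j u) \<subseteq> Rec (n + 1) (ins b i j) \<longleftrightarrow> away \<and> L < i \<and> i \<le> R"
    if i: "i \<in> {1..n + 1}" for i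
  proof -
    have "Des (n + 1) (ins c j u) \<subseteq> Rec (n + 1) (ins b i j) \<longleftrightarrow>
        (\<forall>k. k \<in> Des (n + 1) (ins c j u) \<longrightarrow> k \<in> Des (n + 1) (ins d j i))"
      by (auto simp: Rec_def inv_ins[OF b] d_def)
    also have "\<dots> \<longleftrightarrow> away \<and> (up \<longrightarrow> i \<le> d (j - 1)) \<and> (down \<longrightarrow> d j < i)"
    proof (intro iffI conjI impI)
      assume *: "\<forall>k. k \<in> Des (n + 1) (ins c j u) \<longrightarrow> k \<in> Des (n + 1) (ins d j i)"
      show away
        unfolding away_def
      proof (intro allI impI)
        fix k assume k: "k + 1 \<noteq> j" "k \<in> Des n c"
        show "k \<in> Des n d"
          using k *[rule_format, of k] *[rule_format, of "k + 1"]
          unfolding Des_ins[OF j] by (cases "k + 1 < j") (auto split: if_splits)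
      qed
      show "i \<le> d (j - 1)" if up
        using that up_pos *[rule_format, of "j - 1"] unfolding Des_ins[OF j] up_def by (auto split: if_splits)
      show "d j < i" if down
        using that down_le *[rule_format, of j] unfolding Des_ins[OF j] down_def by (auto split: if_splits)
    next
      assume *: "away \<and> (up \<longrightarrow> i \<le> d (j - 1)) \<and> (down \<longrightarrow> d j < i)"
      show "\<forall>k. k \<in> Des (n + 1) (ins c j u) \<longrightarrow> k \<in> Des (n + 1) (ins d j i)"
      proof (intro allI)
        fix k
        consider "k + 1 < j" | "k + 1 = j" | "k = j" | "k > j" by linarith
        then show "k \<in> Des (n + 1) (ins c j u) \<longrightarrow> k \<in> Des (n + 1) (ins d j i)"
          using * unfolding Des_ins[OF j] away_def up_def down_def
          by cases auto
      qed
    qed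
    also have "\<dots> \<longleftrightarrow> away \<and> L < i \<and> i \<le> R"
      using i by (auto simp: L_def R_def)
    finally show ?thesis .
  qed
  have "(\<Sum>i = 1..n + 1. jump b i j * of_bool (Des (n + 1) (ins c j u) \<subseteq> Rec (n + 1) (ins b i j)))
     = (\<Sum>i = 1..n + 1. of_bool away *
         ((of_bool (j \<le> b i) - of_bool (j \<le> b (i - 1))) * of_bool (L < i \<and> i \<le> R)))"
    by (intro sum.cong refl) (simp only: sub jump_def, simp add: of_bool_conj)
  also have "\<dots> = of_bool away * (if L \<le> R then of_bool (j \<le> b R) - of_bool (j \<le> b L) else 0)"
    unfolding sum_distrib_left[symmetric]
    by (subst sum_telescope_window) (use j d_le[of "j - 1"] in \<open>auto simp: R_def\<close>)
  also have "\<dots> = jump c j u * of_bool (Des n c \<subseteq> Rec n b)"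
  proof -
    have "\<not> j \<le> j - 1" using j by auto
    then have bR: "j \<le> b R \<longleftrightarrow> \<not> up" and bL: "j \<le> b L \<longleftrightarrow> down"
      using j Sym_fixes[OF b, of "n + 1"] Sym_fixes[OF b, of 0] unfolding R_def L_def by (simp_all add: bd)
    have jump: "jump c j u = of_bool (\<not> down) - of_bool up"
      unfolding jump_def up_def down_def by (simp add: not_less)
    have LR: "L \<le> R \<longleftrightarrow> (up \<and> down \<longrightarrow> d j < d (j - 1))"
    proof -
      have "j \<noteq> j - 1" using \<open>\<not> j \<le> j - 1\<close> by linarith
      then have "d j \<noteq> d (j - 1)" by (simp only: d_inj not_False_eq_True)
      moreover have "d j \<le> n + 1" using j d_le[of j] by simp
      ultimately show ?thesis by (auto simp: L_def R_def)
    qed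
    have sub': "Des n c \<subseteq> Rec n b \<longleftrightarrow> away \<and> (j - 1 \<in> Des n c \<longrightarrow> j - 1 \<in> Des n d)"
    proof -
      have "k + 1 = j \<longleftrightarrow> k = j - 1" for k using j by auto
      then show ?thesis unfolding away_def Rec_def d_def[symmetric] subset_iff by metis
    qed
    \<comment> \<open>At a double descent of \<open>ins c j u\<close>, \<open>j - 1\<close> is a descent of \<open>c\<close>, and the interval is nonempty
      exactly if it is also a recoil of \<open>b\<close>; at a double ascent \<open>j - 1\<close> imposes no condition.
      In the other two cases both sides vanish.\<close>
    have both: "j - 1 \<in> Des n c" "j - 1 \<in> Des n d \<longleftrightarrow> d j < d (j - 1)" if up down
      using that up_pos down_le by (auto simp: Des_def up_def down_def)
    have neither: "j - 1 \<notin> Des n c" if "\<not> up" "\<not> down"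
      using that j by (auto simp: Des_def up_def down_def)
    show ?thesis
      unfolding bR bL jump LR sub' using both neither by (cases up; cases down) auto
  qed
  finally show ?thesis .
qed

section \<open>The signed deletion operator\<close>

text \<open>
  Regard a function on permutations as the linear combination of permutations with its values as
  coefficients. Then this operator sends a word \<open>a\<close> of length \<open>n + 1\<close> to the signed sum of the words
  obtained by deleting one letter of \<open>a\<close> and standardizing, where double ascents count \<open>1\<close> and
  double descents \<open>-1\<close>: the coefficient of \<open>b\<close> collects all ways to get \<open>a\<close> from \<open>b\<close> by an
  insertion. Values outside \<open>Sym n\<close> are set to \<open>0\<close> so that the operators for different \<open>n\<close> can be
  added and composed.
\<close>

definition deletion :: "nat \<Rightarrow> ((nat \<Rightarrow> nat) \<Rightarrow> rat) \<Rightarrow> (nat \<Rightarrow> nat) \<Rightarrow> rat" where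
  "deletion n f b =
    (if b \<in> Sym n then \<Sum>i = 1..n + 1. \<Sum>v = 1..n + 1. of_int (jump b i v) * f (ins b i v) else 0)"

lemma deletion_linear: "deletion n (\<lambda>a. x * f a + y * g a) b = x * deletion n f b + y * deletion n g b"
  by (simp add: deletion_def sum_distrib_left sum.distrib algebra_simps)

lemma deletion_expand:
  "(\<Sum>a\<in>Sym (n + 1). deletion n (\<lambda>a'. of_bool (a' = a)) b * f a) = deletion n f b"
proof (cases "b \<in> Sym n")
  case True
  have "(\<Sum>a\<in>Sym (n + 1). deletion n (\<lambda>a'. of_bool (a' = a)) b * f a)
      = (\<Sum>a\<in>Sym (n + 1). \<Sum>i = 1..n + 1. \<Sum>v = 1..n + 1.
          of_int (jump b i v) * (of_bool (ins b i v = a) * f a))"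
    using True by (simp only: deletion_def if_True sum_distrib_right mult.assoc)
  also have "\<dots> = (\<Sum>i = 1..n + 1. \<Sum>a\<in>Sym (n + 1). \<Sum>v = 1..n + 1.
          of_int (jump b i v) * (of_bool (ins b i v = a) * f a))"
    by (rule sum.swap)
  also have "\<dots> = (\<Sum>i = 1..n + 1. \<Sum>v = 1..n + 1. \<Sum>a\<in>Sym (n + 1).
          of_int (jump b i v) * (of_bool (ins b i v = a) * f a))"
    by (intro sum.cong refl sum.swap)
  also have "\<dots> = (\<Sum>i = 1..n + 1. \<Sum>v = 1..n + 1. of_int (jump b i v) * f (ins b i v))"
  proof (intro sum.cong refl)
    fix i v assume "i \<in> {1..n + 1}" "v \<in> {1..n + 1}"
    then have "ins b i v \<in> Sym (n + 1)" by (rule ins_in_Sym[OF True])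
    then have "(\<Sum>a\<in>Sym (n + 1). of_bool (ins b i v = a) * f a) = f (ins b i v)"
      by (subst sum.remove[OF finite_Sym]) (auto intro!: sum.neutral)
    then show "(\<Sum>a\<in>Sym (n + 1). of_int (jump b i v) * (of_bool (ins b i v = a) * f a))
        = of_int (jump b i v) * f (ins b i v)"
      by (simp only: sum_distrib_left[symmetric])
  qed
  finally show ?thesis using True by (simp add: deletion_def)
qed (simp add: deletion_def)

text \<open>
  The entry of the matrix in the coordinates \<open>a = \<sigma>\<^sup>-\<^sup>1\<close>, \<open>w = \<tau>\<^sup>-\<^sup>1\<close>.
\<close>

definition word_entry :: "nat \<Rightarrow> (nat \<Rightarrow> nat) \<Rightarrow> (nat \<Rightarrow> nat) \<Rightarrow> int" where
  "word_entry n a w = of_bool (Des n w \<subseteq> Rec n a)"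

text \<open>
  Both sides are sums over an index \<open>j\<close>: on the left the inserted letter, on the right the position
  of \<open>w\<close> that is deleted. They agree for each \<open>j\<close> separately, by \<open>sum_jump_Des\<close> applied to the unique
  decomposition \<open>w = ins c j u\<close>.
\<close>

lemma deletion_commutes:
  assumes b: "b \<in> Sym n" and w: "w \<in> Sym (n + 1)"
  shows "deletion n (\<lambda>a. of_int (word_entry (n + 1) a w)) b
       = (\<Sum>c\<in>Sym n. of_int (word_entry n b c) * deletion n (\<lambda>a. of_bool (a = w)) c)"
proof -
  define G where "G j c u = jump c j u * word_entry n b c" for j c u
  have slot: "(\<Sum>i = 1..n + 1. jump b i j * word_entry (n + 1) (ins b i j) w)
      = (\<Sum>c\<in>Sym n. \<Sum>u = 1..n + 1. of_bool (ins c j u = w) * G j c u)"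
    if j: "j \<in> {1..n + 1}" for j
  proof -
    have bij: "bij_betw (\<lambda>(c, u). ins c j u) (Sym n \<times> {1..n + 1}) (Sym (n + 1))"
      by (rule bij_betw_ins[OF j])
    obtain c u where cu: "c \<in> Sym n" "u \<in> {1..n + 1}" "w = ins c j u"
      using bij w unfolding bij_betw_def by force
    have "(\<Sum>i = 1..n + 1. jump b i j * word_entry (n + 1) (ins b i j) w) = G j c u"
      using sum_jump_Des[OF b cu(1) j cu(2)] by (simp add: G_def word_entry_def cu(3))
    also have "\<dots> = (\<Sum>(c', u')\<in>Sym n \<times> {1..n + 1}. of_bool (ins c' j u' = w) * G j c' u')"
      using cu by (subst sum.remove[of _ "(c, u)"])
        (auto simp: finite_Sym intro!: sum.neutral dest: ins_cancel)
    finally show ?thesis by (simp only: sum.cartesian_product)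
  qed
  have "(\<Sum>i = 1..n + 1. \<Sum>j = 1..n + 1. jump b i j * word_entry (n + 1) (ins b i j) w)
      = (\<Sum>j = 1..n + 1. \<Sum>c\<in>Sym n. \<Sum>u = 1..n + 1. of_bool (ins c j u = w) * G j c u)"
    by (subst sum.swap) (intro sum.cong refl slot)
  also have "\<dots> = (\<Sum>c\<in>Sym n. \<Sum>j = 1..n + 1. \<Sum>u = 1..n + 1. of_bool (ins c j u = w) * G j c u)"
    by (rule sum.swap)
  finally have "of_int (\<Sum>i = 1..n + 1. \<Sum>j = 1..n + 1. jump b i j * word_entry (n + 1) (ins b i j) w)
      = (of_int (\<Sum>c\<in>Sym n. \<Sum>j = 1..n + 1. \<Sum>u = 1..n + 1. of_bool (ins c j u = w) * G j c u) :: rat)"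
    by (rule arg_cong)
  then show ?thesis
    using b by (simp only: deletion_def if_True of_int_sum of_int_mult of_int_of_bool G_def
        sum_distrib_left mult_ac cong: sum.cong)
qed

lemma Sym_mono: "m \<le> n \<Longrightarrow> Sym m \<subseteq> Sym n"
  by (auto simp: Sym_def intro: permutes_subset)

lemma Sym_Suc_iff: "c \<in> Sym n \<longleftrightarrow> c \<in> Sym (n + 1) \<and> c (n + 1) = n + 1"
proof (intro iffI conjI)
  assume "c \<in> Sym (n + 1) \<and> c (n + 1) = n + 1"
  then have c: "c permutes {1..n + 1}" and last: "c (n + 1) = n + 1" by (auto simp: Sym_def)
  have "c permutes {1..n}"
  proof (rule permutes_superset[OF c])
    fix x assume "x \<in> {1..n + 1} - {1..n}"
    then have "x = n + 1" by auto
    with last show "c x = x" by simp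
  qed
  then show "c \<in> Sym n" by (simp add: Sym_def)
qed (use Sym_mono[of n "n + 1"] Sym_fixes[of c n "n + 1"] in auto)

text \<open>
  A word of length \<open>n + 1\<close> is at the same time the word of length \<open>n + 2\<close> that ends with its
  largest letter. Deleting that last letter gives back the word with sign \<open>1\<close>; deleting any other
  letter leaves the last one in place, where it acts like the boundary value \<open>+\<infinity>\<close>. This is a
  relation \<open>D T = 1 + T D\<close> with \<open>T\<close> appending a new maximum, which here is the inclusion of
  \<open>Sym (n + 1)\<close> in \<open>Sym (n + 2)\<close>.
\<close>

lemma deletion_Suc:
  assumes f: "\<And>a. a \<notin> Sym (n + 1) \<Longrightarrow> f a = 0"
  shows "deletion (n + 1) f b = f b + deletion n f b"
proof (cases "b \<in> Sym (n + 1)")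
  case False
  then show ?thesis using f Sym_mono[of n "n + 1"] by (auto simp: deletion_def)
next
  case b: True
  let ?t = "\<lambda>i v. of_int (jump b i v) * f (ins b i v)"
  have b_last: "b (n + 2) = n + 2" using Sym_fixes[OF b, of "n + 2"] by simp
  have b_le: "b (n + 1) \<le> n + 1"
    using Sym_le[OF b] by simp
  have "ins b i (n + 2) \<notin> Sym (n + 1)" if "i \<le> n + 1" for i
    using Sym_le[of "ins b i (n + 2)" "n + 1" i] that by (auto simp: ins_def)
  then have new_max: "?t i (n + 2) = 0" if "i \<le> n + 1" for i
    using that f by simp
  have "ins b (n + 2) v \<notin> Sym (n + 1)" if "v \<le> n + 1" for v
    using Sym_fixes[of "ins b (n + 2) v" "n + 1" "n + 2"] that by (auto simp: ins_def)
  then have new_last: "?t (n + 2) v = 0" if "v \<le> n + 1" for v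
    using that f by simp
  have "ins b (n + 2) (n + 2) = b"
  proof
    fix k
    show "ins b (n + 2) (n + 2) k = b k"
      using Sym_le[OF b, of k] Sym_fixes[OF b, of k] Sym_fixes[OF b, of "k - 1"]
      by (cases "k < n + 2") (auto simp: ins_def Let_def)
  qed
  then have corner: "?t (n + 2) (n + 2) = f b"
    using b_last b_le by (simp add: jump_def)
  have "deletion (n + 1) f b = (\<Sum>i = 1..n + 2. \<Sum>v = 1..n + 2. ?t i v)"
    using b by (simp add: deletion_def)
  also have "\<dots> = (\<Sum>i = 1..n + 1. \<Sum>v = 1..n + 1. ?t i v) + f b"
  proof -
    have split: "sum h {1..n + 2} = sum h {1..n + 1} + h (n + 2)" for h :: "nat \<Rightarrow> rat" by simp
    have "(\<Sum>v = 1..n + 2. ?t i v) = (\<Sum>v = 1..n + 1. ?t i v)" if "i \<in> {1..n + 1}" for i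
      unfolding split using new_max[of i] that by auto
    moreover have "(\<Sum>v = 1..n + 2. ?t (n + 2) v) = f b"
      unfolding split using new_last by (subst sum.neutral) (auto simp only: corner atLeastAtMost_iff)
    ultimately show ?thesis by (subst split) (simp only: cong: sum.cong)
  qed
  also have "(\<Sum>i = 1..n + 1. \<Sum>v = 1..n + 1. ?t i v) = deletion n f b"
  proof (cases "b \<in> Sym n")
    case False
    then have ne: "b (n + 1) \<noteq> n + 1" using b Sym_Suc_iff by blast
    have "ins b i v \<notin> Sym (n + 1)" if "i \<le> n + 1" "v \<le> n + 1" for i v
      using that ne b_le Sym_fixes[of "ins b i v" "n + 1" "n + 2"]
      by (auto simp: ins_def Let_def split: if_splits)
    then have "?t i v = 0" if "i \<le> n + 1" "v \<le> n + 1" for i v using that f by simp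
    then have "(\<Sum>i = 1..n + 1. \<Sum>v = 1..n + 1. ?t i v) = 0"
      by (intro sum.neutral ballI) (simp only: atLeastAtMost_iff)
    then show ?thesis using False by (simp only: deletion_def if_False)
  qed (simp add: deletion_def)
  finally show ?thesis by simp
qed

lemma deletion_stable:
  assumes "k \<le> n" and "\<And>a. a \<notin> Sym k \<Longrightarrow> f a = 0"
  shows "deletion n f b = of_nat (n - k) * f b + deletion k f b"
  using assms(1)
proof (induction n rule: dec_induct)
  case (step n)
  have "f a = 0" if "a \<notin> Sym (n + 1)" for a
    using that assms(2) Sym_mono[of k "n + 1"] step.hyps by auto
  from deletion_Suc[OF this] show ?case
    using step by (simp add: Suc_diff_le algebra_simps)
qed simp

lemma deletion_0:
  assumes "\<And>a. a \<notin> Sym 0 \<Longrightarrow> f a = 0"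
  shows "deletion 0 f b = f b"
proof -
  have "b \<in> Sym 0 \<longleftrightarrow> b = id" by (auto simp: Sym_def)
  moreover have "ins id 1 1 = id" by (auto simp: ins_def fun_eq_iff Let_def)
  ultimately show ?thesis using assms by (auto simp: deletion_def jump_def)
qed

text \<open>
  On functions supported on \<open>Sym k\<close> the operator is a positive multiple of the identity, plus
  a term supported on \<open>Sym (k - 1)\<close> if \<open>k > 0\<close>. So it can be inverted by induction on \<open>k\<close>; the multiples
  are the reason for working over the rationals.
\<close>

lemma deletion_surj:
  assumes "k \<le> n" and "\<And>a. a \<notin> Sym k \<Longrightarrow> g a = 0"
  shows "\<exists>f. deletion n f = g"
  using assms
proof (induction k arbitrary: g)
  case 0
  have "deletion n (\<lambda>a. inverse (of_nat (n + 1)) * g a + 0 * g a) b = g b" for b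
    using deletion_stable[of 0 n g b] deletion_0[of g b] 0
    by (subst deletion_linear) (simp add: field_simps)
  then show ?case by blast
next
  case (Suc k)
  have "deletion k g a = 0" if "a \<notin> Sym k" for a using that by (simp add: deletion_def)
  then obtain f where f: "deletion n f = deletion k g" using Suc.IH[of "deletion k g"] Suc.prems(1) by auto
  define c :: rat where "c = of_nat (n - Suc k + 1)"
  have c: "c \<noteq> 0" unfolding c_def by (simp only: of_nat_eq_0_iff)
  have "deletion n (\<lambda>a. inverse c * g a + (- inverse c) * f a) b = g b" for b
  proof -
    have "deletion n g b = c * g b + deletion k g b"
      using deletion_stable[OF Suc.prems(1), of g b] deletion_Suc[of k g b] Suc.prems(2)
      by (simp add: c_def algebra_simps)
    then show ?thesis using c by (subst deletion_linear) (simp add: f field_simps)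
  qed
  then show ?case by blast
qed

section \<open>Divisibility of the characteristic polynomials\<close>

theorem mainTheorem1:
  fixes n :: nat and e e' :: "nat \<Rightarrow> nat \<Rightarrow> nat"
  assumes "n \<ge> 1"
    and "enumeration n e"
    and "enumeration (n + 1) e'"
  shows "char_poly (M n e) dvd char_poly (M (n + 1) e')"
proof -
  define N m :: nat where "N = fact (n + 1)" and "m = fact n"
  define E where "E i = Hilbert_Choice.inv (e i)" for i
  define E' where "E' i = Hilbert_Choice.inv (e' i)" for i
  have inv_bij: "bij_betw Hilbert_Choice.inv (Sym k) (Sym k)" for k
    by (rule bij_betwI[of _ _ _ Hilbert_Choice.inv])
       (auto intro: Sym_inv simp: Sym_def permutes_inv_inv permutes_inv)
  have E: "bij_betw E {..<m} (Sym n)"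
    using bij_betw_trans[OF assms(2)[unfolded enumeration_def, folded m_def] inv_bij] by (simp add: E_def[abs_def] o_def)
  have E': "bij_betw E' {..<N} (Sym (n + 1))"
    using bij_betw_trans[OF assms(3)[unfolded enumeration_def, folded N_def] inv_bij] by (simp add: E'_def[abs_def] o_def)
  have e_Sym: "e i \<in> Sym n" if "i < m" for i using assms(2) that by (auto simp: enumeration_def bij_betw_def N_def m_def)
  have e'_Sym: "e' i \<in> Sym (n + 1)" if "i < N" for i using assms(3) that by (auto simp: enumeration_def bij_betw_def N_def m_def)
  have E_Sym: "E i \<in> Sym n" if "i < m" for i using E that by (auto simp: bij_betw_def)
  have E'_Sym: "E' i \<in> Sym (n + 1)" if "i < N" for i using E' that by (auto simp: bij_betw_def)
  have entry: "M_entry k a w = word_entry k (Hilbert_Choice.inv a) (Hilbert_Choice.inv w)"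
    if "a \<in> Sym k" for k a w
    using that by (simp add: M_entry_def word_entry_def Rec_def Sym_def permutes_inv_inv)
  have M: "M n e = mat m m (\<lambda>(i, j). word_entry n (E i) (E j))"
    by (intro eq_matI) (auto simp: M_def E_def entry[OF e_Sym] m_def[symmetric])
  have M': "M (n + 1) e' = mat N N (\<lambda>(i, j). word_entry (n + 1) (E' i) (E' j))"
    using entry[OF e'_Sym] by (intro eq_matI) (auto simp only: M_def E'_def N_def[symmetric] dim_row_mat dim_col_mat index_mat prod.case)
  \<comment> \<open>\<open>D\<close> is the matrix of the deletion operator, \<open>R\<close> a right inverse given by its surjectivity.\<close>
  define D where "D = mat m N (\<lambda>(i, j). deletion n (\<lambda>a. of_bool (a = E' j)) (E i))"
  have "\<exists>f. deletion n f = (\<lambda>a. of_bool (a = E i))" if "i < m" for i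
    using E_Sym[OF that] by (intro deletion_surj[of n]) auto
  then obtain F where F: "\<And>i. i < m \<Longrightarrow> deletion n (F i) = (\<lambda>a. of_bool (a = E i))" by metis
  define R where "R = mat N m (\<lambda>(j, i). F i (E' j))"
  define A :: "rat mat" where "A = map_mat of_int (M (n + 1) e')"
  define B :: "rat mat" where "B = map_mat of_int (M n e)"
  have carriers: "A \<in> carrier_mat N N" "B \<in> carrier_mat m m" "D \<in> carrier_mat m N" "R \<in> carrier_mat N m"
    by (auto simp: A_def B_def D_def R_def M_def N_def m_def)
  have D_apply: "(\<Sum>l = 0..<N. deletion n (\<lambda>a. of_bool (a = E' l)) b * f (E' l)) = deletion n f b" for b f
    using deletion_expand[of n b f] sum.reindex_bij_betw[OF E', of "\<lambda>a. deletion n (\<lambda>a'. of_bool (a' = a)) b * f a"]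
    by (simp add: lessThan_atLeast0)
  have "D * R = 1\<^sub>m m"
  proof (rule eq_matI)
    fix i k assume ik: "i < dim_row (1\<^sub>m m)" "k < dim_col (1\<^sub>m m)"
    then have "(D * R) $$ (i, k) = deletion n (F k) (E i)"
      using D_apply[of "E i" "F k"] by (simp add: D_def R_def scalar_prod_def)
    also have "\<dots> = of_bool (E i = E k)" using F ik by simp
    also have "\<dots> = 1\<^sub>m m $$ (i, k)"
      using ik E by (auto simp: bij_betw_def inj_on_def)
    finally show "(D * R) $$ (i, k) = 1\<^sub>m m $$ (i, k)" .
  qed (simp_all add: D_def R_def)
  moreover have "D * A = B * D"
  proof (rule eq_matI)
    fix i k assume "i < dim_row (B * D)" "k < dim_col (B * D)"
    then have i: "i < m" and k: "k < N" using carriers by auto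
    have "(D * A) $$ (i, k) = deletion n (\<lambda>a. of_int (word_entry (n + 1) a (E' k))) (E i)"
      using i k D_apply[of "E i" "\<lambda>a. of_int (word_entry (n + 1) a (E' k))"]
      unfolding A_def M' by (simp add: D_def scalar_prod_def)
    also have "\<dots> = (\<Sum>c\<in>Sym n. of_int (word_entry n (E i) c) * deletion n (\<lambda>a. of_bool (a = E' k)) c)"
      by (rule deletion_commutes[OF E_Sym[OF i] E'_Sym[OF k]])
    also have "\<dots> = (\<Sum>l = 0..<m. of_int (word_entry n (E i) (E l)) * deletion n (\<lambda>a. of_bool (a = E' k)) (E l))"
      using sum.reindex_bij_betw[OF E, of "\<lambda>c. of_int (word_entry n (E i) c) * deletion n (\<lambda>a. of_bool (a = E' k)) c"]
      by (simp add: lessThan_atLeast0)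
    also have "\<dots> = (B * D) $$ (i, k)"
      using i k unfolding B_def M by (simp add: D_def scalar_prod_def)
    finally show "(D * A) $$ (i, k) = (B * D) $$ (i, k)" .
  qed (use carriers in auto)
  ultimately have "char_poly B dvd char_poly A"
    by (intro char_poly_dvd_if_intertwined[OF carriers])
  moreover have Mc: "M n e \<in> carrier_mat m m" "M (n + 1) e' \<in> carrier_mat N N"
    by (simp_all add: M_def N_def m_def)
  ultimately have "(map_poly of_int (char_poly (M n e)) :: rat poly) dvd map_poly of_int (char_poly (M (n + 1) e'))"
    by (simp add: A_def B_def of_int_hom.char_poly_hom)
  then show ?thesis
    using degree_monic_char_poly[OF Mc(1)] by (intro monic_dvd_if_of_int_poly_dvd) auto
qed

end
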